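(* The map $\Lambda_{\mathrm{Lie}}:\mathcal L(A)\to G^0$, $\Lambda_{\mathrm{Lie}}(\phi)=\sum_{w\in\mathbb N^*}\phi(w)x_w$, defines a Lie algebra isomorphism between the Lie algebras $\mathcal L(A)$ and $(G^0,[-,-])$.
   Context: $\mathbb K$ is a field of characteristic zero, $A$ a commutative unital $\mathbb K$-algebra, $\mathbb N=\{1,2,\dots\}$, $\mathbb N^*$ the set of non-empty finite words over $\mathbb N$, $\mathbf 1$ the empty word. Series side. $R=A\langle\langle x_1,x_2,\dots\rangle\rangle$ is the ring of non-commutative formal power series $f=\sum_{w\in\mathbb N^*\cup\{\mathbf 1\}}f_wx_w$ ($f_w\in A$ arbitrary, $x_w=x_{i_1}\cdots x_{i_m}$ for $w=i_1\cdots i_m$). $G^0=\{f\in R:f_{\mathbf 1}=0\}$, with the Lie bracket $[f,g]=f\triangleleft g-g\triangleleft f$, where $\triangleleft$ is the (right pre-Lie) product given on monomials by $x_{i_1}\cdots x_{i_n}\triangleleft x_{j_1}\cdots x_{j_m}=\sum_{k=0}^n x_{i_1}\cdots x_{i_k}x_{j_1}\cdots x_{j_m}x_{i_{k+1}}\cdots x_{i_n}$ and extended $A$-bilinearly to series (each coefficient is a finite sum). Hopf algebra side. $V$ is the $\mathbb K$-vector space with basis $\mathbb N^*$, and $T(V)=\bigoplus_{n\ge0}V^{\otimes n}$ is its tensor algebra, with unit $\mathbf 1$ (identified with the empty word) and product written with bars, $w_1|\cdots|w_k$. For a word $w=a_1\cdots a_n\in\mathbb N^*$ and $S=\{i_1<\dots<i_k\}\subseteq[n]=\{1,\dots,n\}$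 put $w_S=a_{i_1}\cdots a_{i_k}$ ($w_\varnothing=\mathbf 1$), and let $J_1^S,\dots,J_m^S$ be the maximal intervals (of consecutive integers) of $[n]\setminus S$, in increasing order. The coproduct is the algebra morphism $\Delta:T(V)\to T(V)\otimes T(V)$ with $\Delta(w)=\sum_{S\subseteq[n]}w_S\otimes w_{J_1^S}|\cdots|w_{J_m^S}$. With it, $T(V)$ is a graded connected Hopf algebra. Linear maps $T(V)\to A$ have the convolution product $\phi\ast\psi=m_A(\phi\otimes\psi)\Delta$. $\mathcal L(A)$ is the set of infinitesimal characters, i.e. linear maps $T(V)\to A$ vanishing on $\mathbf 1$ and on $\bigoplus_{n\ge2}V^{\otimes n}$; it is a Lie algebra with bracket $[\phi,\psi]=\phi\ast\psi-\psi\ast\phi$. *)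

theory Defs
  imports Complex_Main "HOL-Library.Poly_Mapping" "HOL-Library.Product_Plus" "HOL-Library.Function_Algebras"
begin

section \<open>Algebras and Lie algebras\<close>

text \<open>The class \<open>comm_ring_1\<close> would impose \<open>0 \<noteq> 1\<close>; the sort
  \<open>{comm_ring, comm_monoid_mult}\<close> is that of all commutative unital rings, the zero ring included.\<close>

locale comm_unital_algebra = vector_space scale
  for scale :: "'k::field \<Rightarrow> 'a::{comm_ring, comm_monoid_mult} \<Rightarrow> 'a" +
  assumes scale_mult_left: "scale c (x * y) = scale c x * y"

text \<open>A Lie algebra over \<open>'k\<close> is carried by a subspace \<open>L\<close> of an ambient vector space;
  nothing is required of the bracket outside \<open>L\<close>.\<close>

locale lie_algebra = vector_space scale
  for scale :: "'k::field \<Rightarrow> 'v::ab_group_add \<Rightarrow> 'v" +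
  fixes L :: "'v set" and bracket :: "'v \<Rightarrow> 'v \<Rightarrow> 'v"
  assumes subspace_L: "subspace L"
    and bracket_closed: "x \<in> L \<Longrightarrow> y \<in> L \<Longrightarrow> bracket x y \<in> L"
    and bracket_add_left: "x \<in> L \<Longrightarrow> y \<in> L \<Longrightarrow> z \<in> L \<Longrightarrow>
      bracket (x + y) z = bracket x z + bracket y z"
    and bracket_add_right: "x \<in> L \<Longrightarrow> y \<in> L \<Longrightarrow> z \<in> L \<Longrightarrow>
      bracket x (y + z) = bracket x y + bracket x z"
    and bracket_scale_left: "x \<in> L \<Longrightarrow> y \<in> L \<Longrightarrow> bracket (scale c x) y = scale c (bracket x y)"
    and bracket_scale_right: "x \<in> L \<Longrightarrow> y \<in> L \<Longrightarrow> bracket x (scale c y) = scale c (bracket x y)"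
    and bracket_self: "x \<in> L \<Longrightarrow> bracket x x = 0"
    and jacobi: "x \<in> L \<Longrightarrow> y \<in> L \<Longrightarrow> z \<in> L \<Longrightarrow>
      bracket x (bracket y z) + bracket y (bracket z x) + bracket z (bracket x y) = 0"

locale lie_algebra_iso =
  dom: lie_algebra scale1 L1 bracket1 + cod: lie_algebra scale2 L2 bracket2
  for scale1 :: "'k::field \<Rightarrow> 'v::ab_group_add \<Rightarrow> 'v" and L1 bracket1
    and scale2 :: "'k \<Rightarrow> 'w::ab_group_add \<Rightarrow> 'w" and L2 bracket2 +
  fixes f :: "'v \<Rightarrow> 'w"
  assumes bij: "bij_betw f L1 L2"
    and map_add: "x \<in> L1 \<Longrightarrow> y \<in> L1 \<Longrightarrow> f (x + y) = f x + f y"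
    and map_scale: "x \<in> L1 \<Longrightarrow> f (scale1 c x) = scale2 c (f x)"
    and map_bracket: "x \<in> L1 \<Longrightarrow> y \<in> L1 \<Longrightarrow> f (bracket1 x y) = bracket2 (f x) (f y)"


section \<open>Words and non-commutative power series\<close>

typedef letter = "{n::nat. 1 \<le> n}"
  by auto

type_synonym word = "letter list"

text \<open>The series \<open>\<Sum>\<^sub>w f\<^sub>w x\<^sub>w\<close> is its coefficient function; addition and scaling are pointwise.\<close>

type_synonym 'a series = "word \<Rightarrow> 'a"

definition G0 :: "'a::zero series set" where
  "G0 = {f. f [] = 0}"

text \<open>The coefficient of \<open>x\<^sub>w\<close> in \<open>f \<triangleleft> g\<close>: by bilinearity, the pair of monomials
  \<open>x\<^sub>u\<close>, \<open>x\<^sub>v\<close> contributes \<open>f\<^sub>u g\<^sub>v\<close> once for every position \<open>k\<close> of \<open>u\<close>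
  at which inserting \<open>v\<close> produces \<open>w\<close>.\<close>

definition insertions :: "word \<Rightarrow> (word \<times> word \<times> nat) set" where
  "insertions w = {(u, v, k). k \<le> length u \<and> take k u @ v @ drop k u = w}"

definition prelie :: "'a::comm_ring series \<Rightarrow> 'a series \<Rightarrow> 'a series" (infixl "\<lhd>" 70) where
  "f \<lhd> g = (\<lambda>w. \<Sum>(u, v, k)\<in>insertions w. f u * g v)"

lemma finite_insertions: "finite (insertions w)"
proof (rule finite_surj)
  show "finite ({..length w} \<times> {..length w})" by simp
  show "insertions w \<subseteq> (\<lambda>(k, m). (take k w @ drop (k + m) w, take m (drop k w), k)) `
      ({..length w} \<times> {..length w})"
  proof
    fix p assume "p \<in> insertions w"
    then obtain u v k where p: "p = (u, v, k)" and k: "k \<le> length u"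
      and w: "w = take k u @ v @ drop k u"
      by (auto simp: insertions_def)
    then have "p = (\<lambda>(k, m). (take k w @ drop (k + m) w, take m (drop k w), k)) (k, length v)"
      by (simp add: min_absorb2)
    then show "p \<in> (\<lambda>(k, m). (take k w @ drop (k + m) w, take m (drop k w), k)) `
        ({..length w} \<times> {..length w})"
      by (rule image_eqI) (use k w in auto)
  qed
qed

definition series_bracket :: "'a::comm_ring series \<Rightarrow> 'a series \<Rightarrow> 'a series" where
  "series_bracket f g = f \<lhd> g - g \<lhd> f"


section \<open>The tensor algebra of the space of non-empty words\<close>

text \<open>A bar word \<open>w\<^sub>1|\<dots>|w\<^sub>n\<close> is a list of non-empty words; for fixed \<open>n\<close> these are the basis
  of the \<open>n\<close>-th tensor power of \<open>V\<close>. Concatenation is written additively because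
  \<^typ>\<open>'b \<Rightarrow>\<^sub>0 'k\<close> is the monoid algebra of an additive monoid \<open>'b\<close>.\<close>

typedef bword = "{ws :: word list. [] \<notin> set ws}"
  morphisms factors Bword
  by (rule exI[of _ "[]"]) simp

text \<open>Empty words among the factors are dropped, i.e. the empty word is identified with the unit.\<close>

definition bars :: "word list \<Rightarrow> bword" where
  "bars ws = Bword (filter (\<lambda>w. w \<noteq> []) ws)"

lemma factors_bars [simp]: "factors (bars ws) = filter (\<lambda>w. w \<noteq> []) ws"
  by (simp add: bars_def Bword_inverse)

lemma bars_factors [simp]: "bars (factors b) = b"
proof -
  have "filter (\<lambda>w. w \<noteq> []) (factors b) = factors b"
    using factors[of b] by (auto simp: filter_id_conv)
  then show ?thesis by (simp add: bars_def factors_inverse)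
qed

instantiation bword :: monoid_add
begin

definition "0 = bars []"

definition "a + b = bars (factors a @ factors b)"

lemma factors_zero [simp]: "factors 0 = []"
  by (simp add: zero_bword_def)

lemma factors_plus [simp]: "factors (a + b) = factors a @ factors b"
  using factors[of a] factors[of b]
  by (metis bars_factors factors_bars filter_append plus_bword_def)

instance
  by standard (simp_all add: factors_inject[symmetric])

end

text \<open>The tensor algebra \<open>T(V)\<close> is the free algebra on \<open>\<nat>\<^sup>*\<close>, i.e. the monoid algebra of bar
  words. The algebra \<open>T(V) \<otimes> T(V)\<close> is the monoid algebra of pairs of bar words: the basis vector
  indexed by \<open>(a, b)\<close> is \<open>a \<otimes> b\<close>, and \<open>(a \<otimes> b)(c \<otimes> d) = ac \<otimes> bd\<close>.\<close>

type_synonym 'k tens = "bword \<Rightarrow>\<^sub>0 'k"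
type_synonym 'k tens2 = "bword \<times> bword \<Rightarrow>\<^sub>0 'k"

definition tscale :: "'k::field \<Rightarrow> ('b \<Rightarrow>\<^sub>0 'k) \<Rightarrow> ('b \<Rightarrow>\<^sub>0 'k)" where
  "tscale c t = Poly_Mapping.map ((*) c) t"

lemma lookup_tscale [simp]: "Poly_Mapping.lookup (tscale c t) b = c * Poly_Mapping.lookup t b"
  by (simp add: tscale_def Poly_Mapping.map.rep_eq when_def)

lemma vector_space_tscale: "vector_space (tscale :: 'k::field \<Rightarrow> ('b \<Rightarrow>\<^sub>0 'k) \<Rightarrow> _)"
  by standard (rule poly_mapping_eqI, simp add: lookup_add algebra_simps)+

definition tword :: "word \<Rightarrow> 'k::field tens" where
  "tword w = Poly_Mapping.single (bars [w]) 1"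


section \<open>The coproduct\<close>

text \<open>Positions in a word are counted from \<open>0\<close>, so that \<open>[n]\<close> becomes \<open>{..<n}\<close>, and
  \<open>w\<^sub>S\<close> is \<open>nths w S\<close>.\<close>

definition max_intervals :: "nat set \<Rightarrow> nat set set" where
  "max_intervals T = {J. J \<noteq> {} \<and> J \<subseteq> T \<and> (\<exists>a b. J = {a..b}) \<and>
     (\<forall>a b. J \<subseteq> {a..b} \<and> {a..b} \<subseteq> T \<longrightarrow> {a..b} = J)}"

definition interval_list :: "nat set \<Rightarrow> nat set list" where
  "interval_list T = sorted_key_list_of_set Min (max_intervals T)"

definition coprod_word :: "word \<Rightarrow> 'k::field tens2" where
  "coprod_word w = (\<Sum>S\<in>Pow {..<length w}. Poly_Mapping.single
     (bars [nths w S], bars (map (nths w) (interval_list ({..<length w} - S)))) 1)"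

text \<open>The linear extension of \<open>w\<^sub>1|\<dots>|w\<^sub>n \<mapsto> \<Delta>(w\<^sub>1)\<cdots>\<Delta>(w\<^sub>n)\<close>.\<close>

definition coprod :: "'k::field tens \<Rightarrow> 'k tens2" where
  "coprod t = (\<Sum>b\<in>Poly_Mapping.keys t. tscale (Poly_Mapping.lookup t b) (prod_list (map coprod_word (factors b))))"

lemma inj_on_Min_max_intervals: "inj_on Min (max_intervals T)"
proof (rule inj_onI)
  fix I J assume I: "I \<in> max_intervals T" and J: "J \<in> max_intervals T" and eq: "Min I = Min J"
  from I obtain a b where ab: "I = {a..b}" "a \<le> b" by (auto simp: max_intervals_def)
  from J obtain c d where cd: "J = {c..d}" "c \<le> d" by (auto simp: max_intervals_def)
  have "Min {a..b} = a" "Min {c..d} = c" using ab cd by (auto intro!: Min_eqI)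
  then have "a = c" using eq ab cd by simp
  have "I \<subseteq> J \<or> J \<subseteq> I" using ab cd \<open>a = c\<close> by (auto simp: nat_le_linear)
  then show "I = J"
    using I J ab cd unfolding max_intervals_def by blast
qed

lemma max_intervals_subset: "max_intervals T \<subseteq> Pow T"
  by (auto simp: max_intervals_def)

lemma sorted_key_list_of_set_class:
  "linorder.sorted_key_list_of_set (\<le>) f = sorted_key_list_of_set (f :: 'b \<Rightarrow> 'c::linorder)"
proof -
  have "linorder.insort_key (\<le>) f x xs = insort_key f x xs" for x xs
    by (induction xs) (simp_all add: linorder.insort_key.simps[OF linorder_class.linorder_axioms])
  then have "linorder.insort_key (\<le>) f = insort_key f" by (intro ext)
  then show ?thesis
    unfolding linorder_class.sorted_key_list_of_set_def
      linorder.sorted_key_list_of_set_def[OF linorder_class.linorder_axioms] by simp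
qed

lemma interval_list:
  assumes "finite T"
  shows "set (interval_list T) = max_intervals T"
    and "sorted (map Min (interval_list T))"
    and "distinct (interval_list T)"
proof -
  have fin: "finite (max_intervals T)"
    using assms max_intervals_subset by (meson finite_Pow_iff finite_subset)
  have L: "folding_insort_key (\<le>) (<) (max_intervals T) Min"
    by standard (rule inj_on_Min_max_intervals)
  note facts = folding_insort_key.sorted_key_list_of_set[OF L subset_refl,
      unfolded sorted_key_list_of_set_class, folded interval_list_def]
  show "set (interval_list T) = max_intervals T"
    by (rule facts(1)[OF fin])
  show "sorted (map Min (interval_list T))"
    by (rule facts(2))
  show "distinct (interval_list T)"
    using facts(3) by (simp add: distinct_map)
qed

lemma coprod_eq_sum:
  assumes "finite B" "Poly_Mapping.keys t \<subseteq> B"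
  shows "coprod t = (\<Sum>b\<in>B. tscale (Poly_Mapping.lookup t b) (prod_list (map coprod_word (factors b))))"
proof -
  interpret vector_space "tscale :: 'a \<Rightarrow> 'a tens2 \<Rightarrow> _" by (rule vector_space_tscale)
  show ?thesis
    unfolding coprod_def using assms by (intro sum.mono_neutral_left) (auto simp: in_keys_iff)
qed

lemma coprod_single:
  "coprod (Poly_Mapping.single b c) = tscale c (prod_list (map coprod_word (factors b)))"
  by (subst coprod_eq_sum[of "{b}"]) auto

lemma coprod_tword: "w \<noteq> [] \<Longrightarrow> coprod (tword w) = coprod_word w"
  unfolding tword_def coprod_single by (auto intro: poly_mapping_eqI)

lemma coprod_one: "coprod 1 = 1"
  unfolding single_one[symmetric] coprod_single by (auto intro: poly_mapping_eqI)

lemma coprod_add: "coprod (s + t) = coprod s + coprod t"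
proof -
  interpret vector_space "tscale :: 'a \<Rightarrow> 'a tens2 \<Rightarrow> _" by (rule vector_space_tscale)
  let ?B = "Poly_Mapping.keys s \<union> Poly_Mapping.keys t"
  have "Poly_Mapping.keys (s + t) \<subseteq> ?B" by (rule Poly_Mapping.keys_add)
  then show ?thesis
    by (subst (1 2 3) coprod_eq_sum[of ?B])
      (auto simp: lookup_add scale_left_distrib sum.distrib)
qed

lemma coprod_tscale: "coprod (tscale c t) = tscale c (coprod t)"
proof -
  interpret vector_space "tscale :: 'a \<Rightarrow> 'a tens2 \<Rightarrow> _" by (rule vector_space_tscale)
  have "Poly_Mapping.keys (tscale c t) \<subseteq> Poly_Mapping.keys t" by (auto simp: in_keys_iff)
  then show ?thesis
    by (subst (1 2) coprod_eq_sum[of "Poly_Mapping.keys t"]) (auto simp: scale_sum_right)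
qed

lemma poly_mapping_additive_induct [case_names single add]:
  fixes f :: "'b \<Rightarrow>\<^sub>0 'c::comm_monoid_add"
  assumes single: "\<And>k v. P (Poly_Mapping.single k v)"
    and add: "\<And>f g. P f \<Longrightarrow> P g \<Longrightarrow> P (f + g)"
  shows "P f"
proof (induction f rule: update_induct)
  case const
  show ?case using single[of undefined 0] by simp
next
  case (update f k v)
  then have "Poly_Mapping.update k v f = f + Poly_Mapping.single k v"
    by (intro poly_mapping_eqI)
      (auto simp: lookup_update lookup_add lookup_single when_def in_keys_iff)
  then show ?case using add[OF update(3) single] by simp
qed

lemma tscale_eq_mult: "tscale c t = Poly_Mapping.single 0 c * t" for t :: "'b::monoid_add \<Rightarrow>\<^sub>0 'k::field"
  unfolding tscale_def by (rule mult_map_scale_conv_mult)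

lemma tscale_mult: "tscale c s * tscale d t = tscale (c * d) (s * t)"
  for s t :: "'b::monoid_add \<Rightarrow>\<^sub>0 'k::field"
proof -
  have comm: "s * Poly_Mapping.single 0 d = Poly_Mapping.single 0 d * s"
  proof (induction s rule: poly_mapping_additive_induct)
    case (single k v)
    then show ?case by (simp add: mult_single mult.commute)
  next
    case (add f g)
    then show ?case by (simp add: algebra_simps)
  qed
  have "tscale c s * tscale d t = Poly_Mapping.single 0 c * (s * Poly_Mapping.single 0 d) * t"
    by (simp add: tscale_eq_mult mult.assoc)
  also have "\<dots> = Poly_Mapping.single 0 c * Poly_Mapping.single 0 d * (s * t)"
    by (simp add: comm mult.assoc)
  finally show ?thesis
    by (simp add: tscale_eq_mult mult_single)
qed

lemma coprod_mult: "coprod (s * t) = coprod s * coprod t"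
proof (induction s rule: poly_mapping_additive_induct)
  case (single k v)
  show ?case
  proof (induction t rule: poly_mapping_additive_induct)
    case (single l u)
    then show ?case by (simp add: mult_single coprod_single tscale_mult)
  next
    case (add f g)
    then show ?case by (simp add: distrib_left coprod_add)
  qed
next
  case (add f g)
  then show ?case by (simp add: distrib_right coprod_add)
qed


section \<open>Infinitesimal characters\<close>

definition convolution ::
  "('k::field \<Rightarrow> 'a::{comm_ring, comm_monoid_mult} \<Rightarrow> 'a) \<Rightarrow>
    ('k tens \<Rightarrow> 'a) \<Rightarrow> ('k tens \<Rightarrow> 'a) \<Rightarrow> 'k tens \<Rightarrow> 'a" where
  "convolution scale \<phi> \<psi> t = (\<Sum>(a, b)\<in>Poly_Mapping.keys (coprod t). scale (Poly_Mapping.lookup (coprod t) (a, b))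
     (\<phi> (Poly_Mapping.single a 1) * \<psi> (Poly_Mapping.single b 1)))"

definition conv_bracket ::
  "('k::field \<Rightarrow> 'a::{comm_ring, comm_monoid_mult} \<Rightarrow> 'a) \<Rightarrow>
    ('k tens \<Rightarrow> 'a) \<Rightarrow> ('k tens \<Rightarrow> 'a) \<Rightarrow> 'k tens \<Rightarrow> 'a" where
  "conv_bracket scale \<phi> \<psi> = convolution scale \<phi> \<psi> - convolution scale \<psi> \<phi>"

definition tens_ge2 :: "'k::field tens set" where
  "tens_ge2 = {t. \<forall>b\<in>Poly_Mapping.keys t. 2 \<le> length (factors b)}"

definition infinitesimal_characters ::
  "('k::field \<Rightarrow> 'a::{comm_ring, comm_monoid_mult} \<Rightarrow> 'a) \<Rightarrow> ('k tens \<Rightarrow> 'a) set" where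
  "infinitesimal_characters scale =
     {\<phi>. Vector_Spaces.linear tscale scale \<phi> \<and> \<phi> 1 = 0 \<and> (\<forall>t\<in>tens_ge2. \<phi> t = 0)}"

definition Lambda_Lie :: "('k::field tens \<Rightarrow> 'a::zero) \<Rightarrow> 'a series" where
  "Lambda_Lie \<phi> = (\<lambda>w. if w = [] then 0 else \<phi> (tword w))"

end

theory Submission
  imports Defs
begin

text \<open>On a single word, \<open>\<phi> * \<psi>\<close> sees only the subsets \<open>S\<close> whose complement is one non-empty interval:
  all others give a bar word of length different from one on the right. Cutting out such an interval is the
  inverse of inserting a word, so \<open>\<Lambda>\<close> carries convolution on words to \<open>\<lhd>\<close>. The Jacobi identity on
  \<open>G\<^sup>0\<close> follows from the pre-Lie identity and is pulled back along \<open>\<Lambda>\<close>.\<close>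

section \<open>The pre-Lie product on series\<close>

text \<open>Replaces the triples of \<open>insertions\<close>: \<open>(p, v, s)\<close> stands for
  inserting \<open>v\<close> into \<open>p @ s\<close> at position \<open>length p\<close>, so that
  iterated insertions become nested factorizations.\<close>

definition splits :: "word \<Rightarrow> (word \<times> word \<times> word) set" where
  "splits w = {(p, v, s). p @ v @ s = w}"

lemma finite_splits [simp]: "finite (splits w)"
proof (rule finite_subset)
  show "splits w \<subseteq> (\<lambda>(i, j). (take i w, take j (drop i w), drop (i + j) w)) ` ({..length w} \<times> {..length w})"
  proof
    fix x assume "x \<in> splits w"
    then obtain p v s where x: "x = (p, v, s)" and w: "w = p @ v @ s" by (auto simp: splits_def)
    show "x \<in> (\<lambda>(i, j). (take i w, take j (drop i w), drop (i + j) w)) ` ({..length w} \<times> {..length w})"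
      by (rule image_eqI[of _ _ "(length p, length v)"]) (simp_all add: x w)
  qed
qed simp

lemma prelie_eq_sum_splits: "(f \<lhd> g) w = (\<Sum>(p, v, s)\<in>splits w. f (p @ s) * g v)"
  unfolding prelie_def
  by (rule sum.reindex_bij_witness[where i = "\<lambda>(p, v, s). (p @ s, v, length p)"
        and j = "\<lambda>(u, v, k). (take k u, v, drop k u)"])
    (auto simp: splits_def insertions_def)

lemma prelie_add_left: "(f + g) \<lhd> h = f \<lhd> h + g \<lhd> h"
  by (rule ext) (simp add: prelie_def split_def distrib_right sum.distrib)

lemma prelie_add_right: "f \<lhd> (g + h) = f \<lhd> g + f \<lhd> h"
  by (rule ext) (simp add: prelie_def split_def distrib_left sum.distrib)

lemma prelie_diff_left: "(f - g) \<lhd> h = f \<lhd> h - g \<lhd> h"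
  by (rule ext) (simp add: prelie_def split_def left_diff_distrib sum_subtractf)

lemma prelie_diff_right: "f \<lhd> (g - h) = f \<lhd> g - f \<lhd> h"
  by (rule ext) (simp add: prelie_def split_def right_diff_distrib sum_subtractf)

text \<open>Two words are inserted at different positions of \<open>a @ b @ c\<close>. With
  \<open>b\<close> empty they would be adjacent, a case already counted in
  \<open>f \<lhd> (g \<lhd> h)\<close>, where the word of \<open>h\<close> may be attached to either
  end of the word of \<open>g\<close>.\<close>

definition double_splits :: "word \<Rightarrow> (word \<times> word \<times> word \<times> word \<times> word) set" where
  "double_splits w = {(a, v1, b, v2, c). a @ v1 @ b @ v2 @ c = w \<and> b \<noteq> []}"

text \<open>Inserting \<open>h\<close> into the result of inserting \<open>g\<close> into \<open>f\<close> either hits the inserted copy of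
  \<open>g\<close>, which accounts for \<open>f \<lhd> (g \<lhd> h)\<close>, or misses it on the left or on the right.\<close>

lemma prelie_associator:
  "((f \<lhd> g) \<lhd> h) w = (f \<lhd> (g \<lhd> h)) w +
     (\<Sum>(a, v1, b, v2, c)\<in>double_splits w. f (a @ b @ c) * (g v1 * h v2 + h v1 * g v2))"
proof -
  \<comment> \<open>First comes the outer factorization, with \<open>v\<close> the word of
    \<open>h\<close>, then that of \<open>p @ s\<close>, with \<open>v'\<close> the word of
    \<open>g\<close>. The cut between \<open>p\<close> and \<open>s\<close> lies strictly left of
    \<open>v'\<close> in \<open>T1\<close>, strictly right of it in \<open>T2\<close>, and inside it
    or at one of its ends in \<open>T3\<close>.\<close>
  define T where "T = Sigma (splits w) (\<lambda>(p, v, s). splits (p @ s))"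
  define F where "F = (\<lambda>((p :: word, v :: word, s :: word), (p' :: word, v' :: word, s' :: word)).
    f (p' @ s') * g v' * h v)"
  define T1 where "T1 = {x \<in> T. case x of ((p, v, s), (p', v', s')) \<Rightarrow> length p < length p'}"
  define T2 where "T2 = {x \<in> T. case x of ((p, v, s), (p', v', s')) \<Rightarrow> length (p' @ v') < length p}"
  define T3 where "T3 = {x \<in> T. case x of ((p, v, s), (p', v', s')) \<Rightarrow>
    length p' \<le> length p \<and> length p \<le> length (p' @ v')}"
  have finT: "finite T" by (auto simp: T_def)
  have "((f \<lhd> g) \<lhd> h) w = sum F T"
    unfolding T_def F_def prelie_eq_sum_splits
    by (simp add: sum_distrib_right split_def sum.Sigma)
  also have "T = T1 \<union> T2 \<union> T3"
    unfolding T1_def T2_def T3_def by (auto simp: not_less)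
  also have "sum F \<dots> = sum F T1 + sum F T2 + sum F T3"
    using finT by (subst sum.union_disjoint; (subst sum.union_disjoint)?) (auto simp: T1_def T2_def T3_def)
  also have "sum F T1 = (\<Sum>(a, v1, b, v2, c)\<in>double_splits w. f (a @ b @ c) * (h v1 * g v2))"
    by (rule sum.reindex_bij_witness[where
          i = "\<lambda>(a, v1, b, v2, c). ((a, v1, b @ v2 @ c), (a @ b, v2, c))"
          and j = "\<lambda>((p, v, s), (p', v', s')). (p, v, drop (length p) p', v', s')"])
      (auto simp: T1_def T_def F_def splits_def double_splits_def append_eq_append_conv2 ac_simps)
  also have "sum F T2 = (\<Sum>(a, v1, b, v2, c)\<in>double_splits w. f (a @ b @ c) * (g v1 * h v2))"
    by (rule sum.reindex_bij_witness[where
          i = "\<lambda>(a, v1, b, v2, c). ((a @ v1 @ b, v2, c), (a, v1, b @ c))"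
          and j = "\<lambda>((p, v, s), (p', v', s')). (p', v', drop (length (p' @ v')) p, v, s)"])
      (auto simp: T2_def T_def F_def splits_def double_splits_def append_eq_append_conv2 ac_simps)
  \<comment> \<open>The word inserted into \<open>p' @ s'\<close> is now \<open>v'\<close> with
    \<open>v\<close> put in at position \<open>length p - length p'\<close>, a word contributing to
    \<open>g \<lhd> h\<close>.\<close>
  also have "sum F T3 = (\<Sum>((p, u, s), (p', v, s'))\<in>Sigma (splits w) (\<lambda>(p, u, s). splits u).
      f (p @ s) * (g (p' @ s') * h v))"
    by (rule sum.reindex_bij_witness[where
          i = "\<lambda>((p, u, s), (p', v, s')). ((p @ p', v, s' @ s), (p, p' @ s', s))"
          and j = "\<lambda>((p, v, s), (p', v', s')). ((p', drop (length p') p @ v @ drop (length p - length p') v', s'),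
              (drop (length p') p, v, drop (length p - length p') v'))"])
      (auto simp: T3_def T_def F_def splits_def append_eq_append_conv2 ac_simps)
  also have "\<dots> = (f \<lhd> (g \<lhd> h)) w"
    unfolding prelie_eq_sum_splits
    by (simp add: sum_distrib_left split_def sum.Sigma)
  finally show ?thesis
    by (simp add: distrib_left split_def sum.distrib ac_simps)
qed

text \<open>The sum over double insertions in \<open>prelie_associator\<close> is symmetric in
  \<open>g\<close> and \<open>h\<close>, hence so is the associator: the product is right
  pre-Lie.\<close>

lemma prelie_identity: "(f \<lhd> g) \<lhd> h - f \<lhd> (g \<lhd> h) = (f \<lhd> h) \<lhd> g - f \<lhd> (h \<lhd> g)"
  by (rule ext) (simp add: prelie_associator add.commute)

lemma series_bracket_jacobi:
  "series_bracket f (series_bracket g h) + series_bracket g (series_bracket h f)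
     + series_bracket h (series_bracket f g) = 0"
proof -
  \<comment> \<open>The pre-Lie identity is solved for the three cyclic products bracketed to the
    left. Rewriting with it leaves only the three anticyclic ones, and all terms cancel.\<close>
  have "(f \<lhd> g) \<lhd> h = f \<lhd> (g \<lhd> h) + ((f \<lhd> h) \<lhd> g - f \<lhd> (h \<lhd> g))"
    "(g \<lhd> h) \<lhd> f = g \<lhd> (h \<lhd> f) + ((g \<lhd> f) \<lhd> h - g \<lhd> (f \<lhd> h))"
    "(h \<lhd> f) \<lhd> g = h \<lhd> (f \<lhd> g) + ((h \<lhd> g) \<lhd> f - h \<lhd> (g \<lhd> f))"
    using prelie_identity[of f g h] prelie_identity[of g h f] prelie_identity[of h f g]
    by (simp_all add: algebra_simps)
  then show ?thesis
    by (simp add: series_bracket_def prelie_diff_left prelie_diff_right)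
qed

section \<open>The Lie algebra of series without constant term\<close>

context comm_unital_algebra
begin

lemma scale_mult_right: "scale c (x * y) = x * scale c y"
  by (metis mult.commute scale_mult_left)

lemma vector_space_pointwise: "vector_space (\<lambda>c (f :: 'b \<Rightarrow> 'a) x. scale c (f x))"
  by standard (simp_all add: fun_eq_iff scale_right_distrib scale_left_distrib)

lemma prelie_scale_left: "(\<lambda>w. scale c (f w)) \<lhd> g = (\<lambda>w. scale c ((f \<lhd> g) w))"
  by (rule ext) (simp add: prelie_def split_def scale_sum_right scale_mult_left)

lemma prelie_scale_right: "f \<lhd> (\<lambda>w. scale c (g w)) = (\<lambda>w. scale c ((f \<lhd> g) w))"
  by (rule ext) (simp add: prelie_def split_def scale_sum_right scale_mult_right)

lemma lie_algebra_G0: "lie_algebra (\<lambda>c f w. scale c (f w)) G0 series_bracket"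
proof -
  interpret S: vector_space "\<lambda>c (f :: 'a series) w. scale c (f w)"
    by (rule vector_space_pointwise)
  \<comment> \<open>The empty word arises only by inserting it into itself, so the constant
    coefficient of \<open>f \<lhd> g\<close> is \<open>f [] * g []\<close>.\<close>
  have "insertions [] = {([], [], 0)}" by (auto simp: insertions_def)
  then have "f \<lhd> g \<in> G0" if "f \<in> G0" for f g :: "'a series"
    using that by (auto simp: G0_def prelie_def)
  then show ?thesis
    apply unfold_locales
    subgoal by (auto simp: S.subspace_def G0_def)
    subgoal by (simp add: G0_def series_bracket_def)
    subgoal by (simp add: series_bracket_def prelie_add_left prelie_add_right)
    subgoal by (simp add: series_bracket_def prelie_add_left prelie_add_right)
    subgoal by (simp add: series_bracket_def prelie_scale_left prelie_scale_right fun_eq_iff scale_right_diff_distrib)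
    subgoal by (simp add: series_bracket_def prelie_scale_left prelie_scale_right fun_eq_iff scale_right_diff_distrib)
    subgoal by (simp add: series_bracket_def)
    subgoal by (rule series_bracket_jacobi)
    done
qed

end

text \<open>Each Lie axiom for \<open>bracket1\<close> is an equation in \<open>L1\<close>;
  \<open>f\<close> sends it to the axiom for \<open>bracket2\<close>, and injectivity brings it
  back. This gives the convolution bracket its Jacobi identity.\<close>

lemma lie_algebra_iso_pullback:
  assumes cod: "lie_algebra scale2 L2 bracket2"
    and dom: "vector_space scale1" "module.subspace scale1 L1"
    and bij: "bij_betw f L1 L2"
    and add: "\<And>x y. x \<in> L1 \<Longrightarrow> y \<in> L1 \<Longrightarrow> f (x + y) = f x + f y"
    and scl: "\<And>x c. x \<in> L1 \<Longrightarrow> f (scale1 c x) = scale2 c (f x)"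
    and closed: "\<And>x y. x \<in> L1 \<Longrightarrow> y \<in> L1 \<Longrightarrow> bracket1 x y \<in> L1"
    and brk: "\<And>x y. x \<in> L1 \<Longrightarrow> y \<in> L1 \<Longrightarrow> f (bracket1 x y) = bracket2 (f x) (f y)"
  shows "lie_algebra_iso scale1 L1 bracket1 scale2 L2 bracket2 f"
proof -
  interpret V: vector_space scale1 by (rule dom(1))
  interpret W: lie_algebra scale2 L2 bracket2 by (rule cod)
  have inj: "x = y" if "f x = f y" "x \<in> L1" "y \<in> L1" for x y
    using that bij by (auto simp: bij_betw_def inj_on_def)
  have mem: "f x \<in> L2" if "x \<in> L1" for x
    using that bij by (auto simp: bij_betw_def)
  note L = V.subspace_add[OF dom(2)] V.subspace_scale[OF dom(2)] V.subspace_0[OF dom(2)] closed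
  have zero: "f 0 = 0"
    using scl[OF L(3), of 0] by simp
  show ?thesis
  proof (unfold_locales)
    fix x y z c assume xyz: "x \<in> L1" "y \<in> L1" "z \<in> L1"
    show "bracket1 (x + y) z = bracket1 x z + bracket1 y z"
      by (rule inj) (simp_all add: xyz L add brk mem W.bracket_add_left)
    show "bracket1 x (y + z) = bracket1 x y + bracket1 x z"
      by (rule inj) (simp_all add: xyz L add brk mem W.bracket_add_right)
    show "bracket1 x (bracket1 y z) + bracket1 y (bracket1 z x) + bracket1 z (bracket1 x y) = 0"
      by (rule inj) (simp_all add: xyz L add brk mem zero W.jacobi)
  next
    fix x y c assume xyz: "x \<in> L1" "y \<in> L1"
    show "bracket1 (scale1 c x) y = scale1 c (bracket1 x y)"
      by (rule inj) (simp_all add: xyz L scl brk mem W.bracket_scale_left)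
    show "bracket1 x (scale1 c y) = scale1 c (bracket1 x y)"
      by (rule inj) (simp_all add: xyz L scl brk mem W.bracket_scale_right)
  next
    fix x assume "x \<in> L1"
    then show "bracket1 x x = 0"
      by (intro inj) (simp_all add: L brk mem zero W.bracket_self)
  qed (fact dom(2) closed bij add scl brk)+
qed


section \<open>Maximal intervals\<close>

text \<open>Among the finitely many intervals inside \<open>T\<close> that contain \<open>x\<close>,
  one being \<open>{x..x}\<close>, take an inclusion-maximal one. Any larger interval inside
  \<open>T\<close> still contains \<open>x\<close>, so it is maximal among all intervals.\<close>

lemma max_intervals_cover:
  assumes "finite T" "x \<in> T"
  shows "\<exists>J\<in>max_intervals T. x \<in> J"
proof -
  define C where "C = {J. J \<subseteq> T \<and> (\<exists>a b. J = {a..b}) \<and> x \<in> J}"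
  have "finite C" using assms(1) by (simp add: C_def)
  moreover have "{x..x} \<in> C" unfolding C_def using assms(2) by (simp, metis atLeastAtMost_singleton)
  ultimately obtain J where J: "J \<in> C" and max: "\<forall>K\<in>C. J \<subseteq> K \<longrightarrow> J = K"
    by (rule finite_has_maximal2[THEN bexE]) blast
  have "{a..b} = J" if "J \<subseteq> {a..b}" "{a..b} \<subseteq> T" for a b
  proof -
    have "x \<in> {a..b}" using J that(1) by (auto simp: C_def)
    then have "{a..b} \<in> C" using that(2) unfolding C_def by blast
    then show ?thesis using max that(1) by blast
  qed
  moreover have "x \<in> J" "J \<subseteq> T" "\<exists>a b. J = {a..b}"
    using J by (simp_all add: C_def)
  ultimately have "J \<in> max_intervals T"
    unfolding max_intervals_def by blast
  then show ?thesis using \<open>x \<in> J\<close> by (rule bexI[rotated])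
qed

lemma max_intervals_interval:
  assumes "i < j" shows "max_intervals {i..<j} = {{i..<j::nat}}"
proof -
  have eq: "{i..<j} = {i..j - 1}" using assms by auto
  show ?thesis
    unfolding max_intervals_def eq using assms by (auto simp: eq)
qed

text \<open>Singles out the subsets whose right tensor factor is one word. Maximal intervals cover
  \<open>T\<close>, so a unique one must be all of \<open>T\<close>.\<close>

lemma interval_list_eq_singleton_iff:
  assumes "finite T"
  shows "interval_list T = [J] \<longleftrightarrow> J = T \<and> (\<exists>i j. i < j \<and> T = {i..<j})"
proof
  assume "interval_list T = [J]"
  then have J: "max_intervals T = {J}"
    using interval_list(1)[OF assms] by simp
  then have "J \<in> max_intervals T" by simp
  then obtain a b where "J = {a..b}" "a \<le> b" by (auto simp: max_intervals_def)
  then have "J = {a..<Suc b}" "a < Suc b" by auto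
  moreover have "J = T"
    using J max_intervals_cover[OF assms] max_intervals_subset[of T] by fastforce
  ultimately show "J = T \<and> (\<exists>i j. i < j \<and> T = {i..<j})" by blast
next
  assume "J = T \<and> (\<exists>i j. i < j \<and> T = {i..<j})"
  then have "set (interval_list T) = {J}"
    using interval_list(1)[OF assms] max_intervals_interval by auto
  moreover from this have "length (interval_list T) = 1"
    using distinct_card[OF interval_list(3)[OF assms]] by simp
  ultimately show "interval_list T = [J]"
    by (auto simp: length_Suc_conv)
qed

section \<open>Subwords cut out by sets of positions\<close>

lemma nths_eq_Nil_iff: "nths xs I = [] \<longleftrightarrow> I \<inter> {..<length xs} = {}"
proof -
  have "nths xs I = [] \<longleftrightarrow> set (nths xs I) = {}" by simp
  also have "\<dots> \<longleftrightarrow> I \<inter> {..<length xs} = {}" by (auto simp: set_nths)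
  finally show ?thesis .
qed

text \<open>Maximal intervals are non-empty and lie within the word, so \<open>bars\<close> drops
  nothing and the number of bar factors is the number of intervals.\<close>

lemma factors_interval_list:
  assumes "T \<subseteq> {..<length w}"
  shows "factors (bars (map (nths w) (interval_list T))) = map (nths w) (interval_list T)"
proof -
  have fin: "finite T" using assms finite_subset by blast
  have "nths w J \<noteq> []" if "J \<in> set (interval_list T)" for J
    using that assms unfolding interval_list(1)[OF fin]
    by (auto simp: nths_eq_Nil_iff max_intervals_def)
  then show ?thesis by (auto simp: filter_id_conv)
qed

lemma nths_complement_interval:
  "nths (p @ v @ s) ({..<length (p @ v @ s)} - {length p..<length (p @ v)}) = p @ s"
proof -
  have "nths p ({..<length (p @ v @ s)} - {length p..<length (p @ v)}) = p"
    by (rule nths_all) auto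
  moreover have "nths v {j. j + length p \<in> {..<length (p @ v @ s)} - {length p..<length (p @ v)}} = []"
    by (auto simp: nths_eq_Nil_iff)
  moreover have "nths s {j. j + length v + length p \<in> {..<length (p @ v @ s)} - {length p..<length (p @ v)}} = s"
    by (rule nths_all) auto
  ultimately show ?thesis by (simp add: nths_append)
qed

lemma nths_interval: "nths (p @ v @ s) {length p..<length (p @ v)} = v"
proof -
  have "nths p {length p..<length (p @ v)} = []"
    by (auto simp: nths_eq_Nil_iff)
  moreover have "nths v {j. j + length p \<in> {length p..<length (p @ v)}} = v"
    by (rule nths_all) auto
  moreover have "nths s {j. j + length v + length p \<in> {length p..<length (p @ v)}} = []"
    by (auto simp: nths_eq_Nil_iff)
  ultimately show ?thesis by (simp add: nths_append)
qed


lemma Min_Max_interval: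
  assumes "i < (j::nat)"
  shows "Min {i..<j} = i" "Suc (Max {i..<j}) = j"
proof -
  show "Min {i..<j} = i" using assms by (intro Min_eqI) auto
  have "Max {i..<j} = j - 1" using assms by (intro Max_eqI) auto
  then show "Suc (Max {i..<j}) = j" using assms by simp
qed


section \<open>Convolution of infinitesimal characters\<close>

text \<open>The filtration of the tensor square by the total number of bar factors. It is
  multiplicative, and from weight 3 on a pair of infinitesimal characters vanishes.\<close>

definition weight_ge :: "nat \<Rightarrow> 'k::field tens2 set" where
  "weight_ge n = {X. \<forall>(a, b)\<in>Poly_Mapping.keys X. n \<le> length (factors a) + length (factors b)}"

lemma weight_ge_add: "X \<in> weight_ge n \<Longrightarrow> Y \<in> weight_ge n \<Longrightarrow> X + Y \<in> weight_ge n"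
  using Poly_Mapping.keys_add[of X Y] by (auto simp: weight_ge_def)

lemma weight_ge_sum: "(\<And>i. i \<in> I \<Longrightarrow> X i \<in> weight_ge n) \<Longrightarrow> sum X I \<in> weight_ge n"
proof (induction I rule: infinite_finite_induct)
  case (insert i I)
  then show ?case by (simp add: weight_ge_add)
qed (simp_all add: weight_ge_def)

lemma weight_ge_mult:
  assumes "X \<in> weight_ge m" "Y \<in> weight_ge n"
  shows "X * Y \<in> weight_ge (m + n)"
  using assms keys_mult[of X Y] by (fastforce simp: weight_ge_def)

lemma weight_ge_single:
  "n \<le> length (factors a) + length (factors b) \<Longrightarrow> Poly_Mapping.single (a, b) c \<in> weight_ge n"
  by (auto simp: weight_ge_def)

lemma weight_ge_mono: "X \<in> weight_ge n \<Longrightarrow> m \<le> n \<Longrightarrow> X \<in> weight_ge m"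
  by (fastforce simp: weight_ge_def)

text \<open>The full set of positions and the empty set give the two primitive terms. Every other
  \<open>S\<close> leaves a non-empty word on the left and at least one interval on the
  right.\<close>

lemma coprod_word_primitive_part:
  assumes "w \<noteq> []"
  obtains R where "R \<in> weight_ge 2"
    and "coprod_word w = Poly_Mapping.single (bars [w], 0) 1 + Poly_Mapping.single (0, bars [w]) 1 + R"
proof -
  let ?N = "{..<length w}"
  let ?t = "\<lambda>S. Poly_Mapping.single
     (bars [nths w S], bars (map (nths w) (interval_list (?N - S)))) 1"
  let ?R = "\<Sum>S\<in>Pow ?N - {?N, {}}. ?t S"
  have ne: "?N \<noteq> {}" using assms by auto
  have "max_intervals {} = {}" by (auto simp: max_intervals_def)
  then have i0: "interval_list {} = []"
    using interval_list(1)[of "{}"] by simp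
  have iN: "interval_list ?N = [?N]"
    using ne by (subst interval_list_eq_singleton_iff) (auto simp: lessThan_atLeast0)
  have bNil: "bars [] = 0" "bars [[]] = 0" by (simp_all add: zero_bword_def bars_def)
  have "coprod_word w = sum ?t {?N, {}} + ?R"
    unfolding coprod_word_def
    by (subst sum.subset_diff[of "{?N, {}}"]) (auto simp: add.commute)
  also have "sum ?t {?N, {}} = ?t ?N + ?t {}"
    using ne by simp
  also have "?t ?N = Poly_Mapping.single (bars [w], 0) 1"
    by (simp add: i0 bNil nths_all)
  also have "?t {} = Poly_Mapping.single (0, bars [w]) 1"
    by (simp add: iN bNil nths_all)
  finally have eq: "coprod_word w = Poly_Mapping.single (bars [w], 0) 1 + Poly_Mapping.single (0, bars [w]) 1 + ?R"
    .
  have "?R \<in> weight_ge 2"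
  proof (rule weight_ge_sum, rule weight_ge_single)
    fix S assume S: "S \<in> Pow ?N - {?N, {}}"
    then obtain x where "x \<in> ?N - S" by blast
    then have "interval_list (?N - S) \<noteq> []"
      using max_intervals_cover[of "?N - S" x] interval_list(1)[of "?N - S"] by auto
    moreover have "nths w S \<noteq> []"
      using S by (auto simp: nths_eq_Nil_iff)
    ultimately show "2 \<le> length (factors (bars [nths w S]))
        + length (factors (bars (map (nths w) (interval_list (?N - S)))))"
      by (subst factors_interval_list) (auto simp: Suc_le_eq)
  qed
  with eq show ?thesis by (rule that[rotated])
qed

lemma coprod_word_weight:
  assumes "w \<noteq> []" shows "(coprod_word w :: 'k::field tens2) \<in> weight_ge 1"
proof -
  obtain R :: "'k tens2" where "R \<in> weight_ge 2"
    and "coprod_word w = Poly_Mapping.single (bars [w], 0) 1 + Poly_Mapping.single (0, bars [w]) 1 + R"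
    using coprod_word_primitive_part[OF assms] .
  moreover from this(1) have "R \<in> weight_ge 1" by (rule weight_ge_mono) simp
  ultimately show ?thesis
    using assms by (simp add: weight_ge_add weight_ge_single)
qed

lemma prod_coprod_word_weight:
  "[] \<notin> set ws \<Longrightarrow> prod_list (map coprod_word ws) \<in> weight_ge (length ws)"
proof (induction ws)
  case Nil
  show ?case by (simp add: weight_ge_def)
next
  case (Cons w ws)
  then show ?case
    using weight_ge_mult[OF coprod_word_weight, of w "prod_list (map coprod_word ws)" "length ws"]
    by auto
qed

section \<open>Linear extension and the bijection with series\<close>

context comm_unital_algebra
begin

text \<open>The basis type is arbitrary so that the same extension serves the tensor algebra and its
  tensor square.\<close>

definition lin_ext :: "('b \<Rightarrow> 'a) \<Rightarrow> ('b \<Rightarrow>\<^sub>0 'k) \<Rightarrow> 'a" where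
  "lin_ext F t = (\<Sum>b\<in>Poly_Mapping.keys t. scale (Poly_Mapping.lookup t b) (F b))"

lemma lin_ext_eq_sum:
  assumes "finite B" "Poly_Mapping.keys t \<subseteq> B"
  shows "lin_ext F t = (\<Sum>b\<in>B. scale (Poly_Mapping.lookup t b) (F b))"
  unfolding lin_ext_def using assms by (intro sum.mono_neutral_left) (auto simp: in_keys_iff)

lemma lin_ext_single [simp]: "lin_ext F (Poly_Mapping.single b c) = scale c (F b)"
  by (subst lin_ext_eq_sum[of "{b}"]) auto

lemma lin_ext_zero [simp]: "lin_ext F 0 = 0"
  by (simp add: lin_ext_def)

lemma lin_ext_add: "lin_ext F (s + t) = lin_ext F s + lin_ext F t"
proof -
  let ?B = "Poly_Mapping.keys s \<union> Poly_Mapping.keys t"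
  have "Poly_Mapping.keys (s + t) \<subseteq> ?B" by (rule Poly_Mapping.keys_add)
  then show ?thesis
    by (subst (1 2 3) lin_ext_eq_sum[of ?B])
      (auto simp: lookup_add scale_left_distrib sum.distrib)
qed

lemma lin_ext_sum: "lin_ext F (sum t I) = (\<Sum>i\<in>I. lin_ext F (t i))"
  by (induction I rule: infinite_finite_induct) (simp_all add: lin_ext_add)

lemma lin_ext_tscale: "lin_ext F (tscale c t) = scale c (lin_ext F t)"
proof -
  have "Poly_Mapping.keys (tscale c t) \<subseteq> Poly_Mapping.keys t" by (auto simp: in_keys_iff)
  then show ?thesis
    by (subst (1 2) lin_ext_eq_sum[of "Poly_Mapping.keys t"]) (auto simp: scale_sum_right)
qed

lemma linear_tscaleI:
  assumes "\<And>s t. \<phi> (s + t) = \<phi> s + \<phi> t" "\<And>c t. \<phi> (tscale c t) = scale c (\<phi> t)"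
  shows "Vector_Spaces.linear tscale scale (\<phi> :: ('b \<Rightarrow>\<^sub>0 'k) \<Rightarrow> 'a)"
  unfolding Vector_Spaces.linear_iff
  using assms vector_space_tscale vector_space_axioms by blast

lemma linear_eq_lin_ext:
  assumes "Vector_Spaces.linear tscale scale \<phi>"
  shows "\<phi> t = lin_ext (\<lambda>b. \<phi> (Poly_Mapping.single b 1)) t"
proof (induction t rule: poly_mapping_additive_induct)
  case (single k v)
  have "Poly_Mapping.single k v = tscale v (Poly_Mapping.single k 1)"
    by (rule poly_mapping_eqI) (simp add: lookup_single when_def)
  then show ?case
    using assms by (simp add: Vector_Spaces.linear_iff lin_ext_tscale)
next
  case (add s t)
  then show ?case
    using assms by (simp add: Vector_Spaces.linear_iff lin_ext_add)
qed

text \<open>By linearity the vanishing can be tested on basis vectors: the bar word without factors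
  is the unit, and those with at least two factors span \<open>tens_ge2\<close>.\<close>

lemma infinitesimal_characters_iff:
  "\<phi> \<in> infinitesimal_characters scale \<longleftrightarrow> Vector_Spaces.linear tscale scale \<phi> \<and>
     (\<forall>b. length (factors b) \<noteq> 1 \<longrightarrow> \<phi> (Poly_Mapping.single b 1) = 0)"
proof (intro iffI conjI allI impI)
  fix b assume \<phi>: "\<phi> \<in> infinitesimal_characters scale" and b: "length (factors b) \<noteq> 1"
  show "\<phi> (Poly_Mapping.single b 1) = 0"
  proof (cases "factors b")
    case Nil
    then have "b = 0" by (metis factors_inject factors_zero)
    then show ?thesis using \<phi> by (simp add: infinitesimal_characters_def)
  next
    case (Cons w ws)
    then have "Poly_Mapping.single b (1 :: 'k) \<in> tens_ge2"
      using b by (cases ws) (auto simp: tens_ge2_def)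
    then show ?thesis using \<phi> by (auto simp: infinitesimal_characters_def)
  qed
next
  assume "\<phi> \<in> infinitesimal_characters scale"
  then show "Vector_Spaces.linear tscale scale \<phi>" by (simp add: infinitesimal_characters_def)
next
  assume *: "Vector_Spaces.linear tscale scale \<phi> \<and>
     (\<forall>b. length (factors b) \<noteq> 1 \<longrightarrow> \<phi> (Poly_Mapping.single b 1) = 0)"
  have "\<phi> t = 0" if "t \<in> tens_ge2" for t
    using * that by (subst linear_eq_lin_ext) (auto simp: lin_ext_def tens_ge2_def intro!: sum.neutral)
  moreover have "\<phi> 1 = 0"
    using * by (simp flip: single_one)
  ultimately show "\<phi> \<in> infinitesimal_characters scale"
    using * by (simp add: infinitesimal_characters_def)
qed

text \<open>This includes \<open>w = []\<close>: \<open>bars [[]]\<close> is the unit, where \<phi>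
  vanishes, in agreement with the value \<open>0\<close> in \<open>Lambda_Lie\<close>.\<close>

lemma infinitesimal_character_bars:
  assumes "\<phi> \<in> infinitesimal_characters scale"
  shows "\<phi> (Poly_Mapping.single (bars [w]) 1) = Lambda_Lie \<phi> w"
  using assms by (auto simp: infinitesimal_characters_iff Lambda_Lie_def tword_def)

lemma bars_hd: "length (factors b) = 1 \<Longrightarrow> bars [hd (factors b)] = b"
  by (metis bars_factors length_0_conv length_Suc_conv list.sel(1) One_nat_def)

lemma bij_betw_Lambda_Lie: "bij_betw Lambda_Lie (infinitesimal_characters scale) G0"
proof -
  define c :: "bword \<Rightarrow> bool" where "c b \<longleftrightarrow> length (factors b) = 1" for b
  \<comment> \<open>The inverse of \<open>Lambda_Lie\<close>: the coefficients of the series are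
    prescribed on bar words with one factor, zero on all others, and extended linearly.\<close>
  define \<Theta> :: "'a series \<Rightarrow> 'k tens \<Rightarrow> 'a" where
    "\<Theta> f = lin_ext (\<lambda>b. if c b then f (hd (factors b)) else 0)" for f
  show ?thesis
  proof (rule bij_betw_byWitness[where f' = \<Theta>])
    show "\<forall>\<phi>\<in>infinitesimal_characters scale. \<Theta> (Lambda_Lie \<phi>) = \<phi>"
    proof (intro ballI ext)
      fix \<phi> t assume \<phi>: "\<phi> \<in> infinitesimal_characters scale"
      have "(if c b then Lambda_Lie \<phi> (hd (factors b)) else 0) = \<phi> (Poly_Mapping.single b 1)" for b
        using \<phi> bars_hd[of b]
        by (auto simp: c_def infinitesimal_characters_iff simp flip: infinitesimal_character_bars[OF \<phi>])
      then show "\<Theta> (Lambda_Lie \<phi>) t = \<phi> t"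
        using \<phi> by (simp add: \<Theta>_def linear_eq_lin_ext[of \<phi> t] infinitesimal_characters_iff)
    qed
    show "\<forall>f\<in>G0. Lambda_Lie (\<Theta> f) = f"
      by (auto simp: Lambda_Lie_def \<Theta>_def tword_def G0_def c_def fun_eq_iff)
    show "Lambda_Lie ` infinitesimal_characters scale \<subseteq> G0"
      by (auto simp: G0_def Lambda_Lie_def)
    show "\<Theta> ` G0 \<subseteq> infinitesimal_characters scale"
      by (auto simp: infinitesimal_characters_iff \<Theta>_def c_def lin_ext_add lin_ext_tscale intro!: linear_tscaleI)
  qed
qed

section \<open>Convolution on words and on bar words\<close>

lemma convolution_eq_lin_ext:
  "convolution scale \<phi> \<psi> t =
     lin_ext (\<lambda>(a, b). \<phi> (Poly_Mapping.single a 1) * \<psi> (Poly_Mapping.single b 1)) (coprod t)"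
  by (simp add: convolution_def lin_ext_def split_def)

lemma convolution_tword:
  assumes \<phi>: "\<phi> \<in> infinitesimal_characters scale" and \<psi>: "\<psi> \<in> infinitesimal_characters scale"
    and w: "w \<noteq> []"
  shows "convolution scale \<phi> \<psi> (tword w) = (Lambda_Lie \<phi> \<lhd> Lambda_Lie \<psi>) w"
proof -
  let ?N = "{..<length w}"
  let ?f = "Lambda_Lie \<phi>" and ?g = "Lambda_Lie \<psi>"
  let ?b = "\<lambda>S. bars (map (nths w) (interval_list (?N - S)))"
  define I where "I = {S \<in> Pow ?N. \<exists>i j. i < j \<and> ?N - S = {i..<j}}"
  have g: "\<psi> (Poly_Mapping.single (?b S) 1) = (if S \<in> I then ?g (nths w (?N - S)) else 0)"
    if "S \<in> Pow ?N" for S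
  proof (cases "S \<in> I")
    case True
    then have "interval_list (?N - S) = [?N - S]"
      by (subst interval_list_eq_singleton_iff) (auto simp: I_def)
    with True show ?thesis
      by (simp add: infinitesimal_character_bars[OF \<psi>])
  next
    case False
    have "length (interval_list (?N - S)) \<noteq> 1"
    proof
      assume "length (interval_list (?N - S)) = 1"
      then obtain J where "interval_list (?N - S) = [J]"
        by (auto simp: length_Suc_conv)
      with False that show False
        by (subst (asm) interval_list_eq_singleton_iff) (auto simp: I_def)
    qed
    then have "length (factors (?b S)) \<noteq> 1"
      by (subst factors_interval_list) auto
    with False \<psi> show ?thesis
      by (simp add: infinitesimal_characters_iff)
  qed
  have "convolution scale \<phi> \<psi> (tword w) =
      (\<Sum>S\<in>Pow ?N. ?f (nths w S) * \<psi> (Poly_Mapping.single (?b S) 1))"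
    unfolding convolution_eq_lin_ext coprod_tword[OF w] coprod_word_def
    by (simp add: lin_ext_sum infinitesimal_character_bars[OF \<phi>])
  also have "\<dots> = (\<Sum>S\<in>Pow ?N. if S \<in> I then ?f (nths w S) * ?g (nths w (?N - S)) else 0)"
    by (rule sum.cong) (simp_all add: g)
  also have "\<dots> = (\<Sum>S\<in>I. ?f (nths w S) * ?g (nths w (?N - S)))"
    by (rule sum.mono_neutral_cong_right) (auto simp: I_def)
  \<comment> \<open>A subset \<open>S\<close> in \<open>I\<close> corresponds to the factorization
    whose middle word \<open>v\<close> occupies the complement of \<open>S\<close>; \<open>v\<close>
    is non-empty since the interval is. The \<open>Suc\<close> turns the last position of
    \<open>v\<close> into the start of the suffix.\<close>
  also have "\<dots> = (\<Sum>(p, v, s)\<in>{(p, v, s) \<in> splits w. v \<noteq> []}. ?f (p @ s) * ?g v)"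
  proof (rule sum.reindex_bij_witness[symmetric, where
        i = "\<lambda>S. (take (Min (?N - S)) w, nths w (?N - S), drop (Suc (Max (?N - S))) w)"
        and j = "\<lambda>(p, v, s). ?N - {length p..<length (p @ v)}"])
    fix S assume "S \<in> I"
    then obtain i j where S: "S \<subseteq> ?N" and ij: "i < j" and eq: "?N - S = {i..<j}"
      by (auto simp: I_def)
    have S': "?N - {i..<j} = S" using S eq by blast
    have "j - 1 \<in> ?N - S" using ij by (auto simp: eq)
    then have j: "j \<le> length w" by auto
    define p v s where "p = take i w" and "v = drop i (take j w)" and "s = drop j w"
    have "take i w @ drop i (take j w) = take j w"
      using append_take_drop_id[of i "take j w"] ij by (simp add: min_def)
    then have pvs: "p @ v @ s = w"
      unfolding p_def v_def s_def by (metis append.assoc append_take_drop_id)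
    have len: "length p = i" "length (p @ v) = j"
      using ij j by (simp_all add: p_def v_def)
    have v: "nths w {i..<j} = v"
      using nths_interval[of p v s] unfolding pvs len .
    have mm: "Min {i..<j} = i" "Suc (Max {i..<j}) = j"
      using Min_Max_interval[OF ij] by blast+
    show "(case (take (Min (?N - S)) w, nths w (?N - S), drop (Suc (Max (?N - S))) w) of
        (p, v, s) \<Rightarrow> ?N - {length p..<length (p @ v)}) = S"
      unfolding eq mm v prod.case p_def[symmetric] len by (rule S')
    show "(take (Min (?N - S)) w, nths w (?N - S), drop (Suc (Max (?N - S))) w)
        \<in> {(p, v, s) \<in> splits w. v \<noteq> []}"
      using pvs ij len unfolding eq mm v by (auto simp: splits_def p_def s_def)
  next
    fix x assume "x \<in> {(p, v, s) \<in> splits w. v \<noteq> []}"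
    then obtain p v s where x: "x = (p, v, s)" and pvs: "w = p @ v @ s" and v: "v \<noteq> []"
      by (auto simp: splits_def)
    let ?S = "?N - {length p..<length (p @ v)}"
    have c: "?N - ?S = {length p..<length (p @ v)}"
      using pvs by auto
    have lt: "length p < length (p @ v)" using v by simp
    have vS: "nths w (?N - ?S) = v"
      unfolding c using nths_interval pvs by metis
    have uS: "nths w ?S = p @ s"
      using nths_complement_interval pvs by metis
    have mm: "Min {length p..<length (p @ v)} = length p"
      "Suc (Max {length p..<length (p @ v)}) = length (p @ v)"
      using Min_Max_interval[OF lt] by blast+
    show "(case x of (p, v, s) \<Rightarrow> ?N - {length p..<length (p @ v)}) \<in> I"
      unfolding x prod.case I_def using c lt by blast
    show "(\<lambda>S. (take (Min (?N - S)) w, nths w (?N - S), drop (Suc (Max (?N - S))) w))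
        (case x of (p, v, s) \<Rightarrow> ?N - {length p..<length (p @ v)}) = x"
      unfolding x prod.case vS unfolding c mm by (simp add: pvs)
    show "?f (nths w (case x of (p, v, s) \<Rightarrow> ?N - {length p..<length (p @ v)})) *
        ?g (nths w (?N - (case x of (p, v, s) \<Rightarrow> ?N - {length p..<length (p @ v)}))) =
        (case x of (p, v, s) \<Rightarrow> ?f (p @ s) * ?g v)"
      unfolding x prod.case vS uS ..
  qed
  \<comment> \<open>The terms with \<open>v = []\<close> may be added because
    \<open>Lambda_Lie \<psi>\<close> has zero constant coefficient.\<close>
  also have "\<dots> = (?f \<lhd> ?g) w"
    unfolding prelie_eq_sum_splits
    by (rule sum.mono_neutral_left) (auto simp: Lambda_Lie_def)
  finally show ?thesis .
qed

lemma Lambda_Lie_conv_bracket: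
  assumes "\<phi> \<in> infinitesimal_characters scale" "\<psi> \<in> infinitesimal_characters scale"
  shows "Lambda_Lie (conv_bracket scale \<phi> \<psi>) = series_bracket (Lambda_Lie \<phi>) (Lambda_Lie \<psi>)"
proof
  fix w
  \<comment> \<open>At the empty word both pre-Lie products reduce to one and the same term, by
    commutativity, and their difference is zero.\<close>
  have "insertions [] = {([], [], 0)}" by (auto simp: insertions_def)
  then show "Lambda_Lie (conv_bracket scale \<phi> \<psi>) w = series_bracket (Lambda_Lie \<phi>) (Lambda_Lie \<psi>) w"
    using assms
    by (cases "w = []")
      (simp_all add: Lambda_Lie_def[of "\<lambda>t. _ t - _ t"] Lambda_Lie_def[of "_ - _"] conv_bracket_def
        series_bracket_def convolution_tword, simp add: prelie_def mult.commute)
qed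

text \<open>On bar words of length at least two, only \<open>w\<^sub>1|w\<^sub>2 \<mapsto> \<phi>(w\<^sub>1)\<psi>(w\<^sub>2) + \<phi>(w\<^sub>2)\<psi>(w\<^sub>1)\<close> survives in the
  convolution, and this cancels in the bracket because \<open>A\<close> is commutative.\<close>

lemma convolution_commute:
  assumes \<phi>: "\<phi> \<in> infinitesimal_characters scale" and \<psi>: "\<psi> \<in> infinitesimal_characters scale"
    and b: "length (factors b) \<noteq> 1"
  shows "convolution scale \<phi> \<psi> (Poly_Mapping.single b 1) = convolution scale \<psi> \<phi> (Poly_Mapping.single b 1)"
proof -
  let ?F = "\<lambda>\<phi> \<psi> (a, b). \<phi> (Poly_Mapping.single a (1 :: 'k)) * (\<psi> (Poly_Mapping.single b (1 :: 'k)) :: 'a)"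
  let ?X = "prod_list (map coprod_word (factors b)) :: 'k tens2"
  have conv: "convolution scale \<phi> \<psi> (Poly_Mapping.single b 1) = lin_ext (?F \<phi> \<psi>) ?X" for \<phi> \<psi>
    unfolding convolution_eq_lin_ext coprod_single lin_ext_tscale by simp
  \<comment> \<open>Weight at least 3 forbids exactly one factor on each side, so one of the two
    characters vanishes on its side.\<close>
  have van: "lin_ext (?F \<phi> \<psi>) X = 0"
    if "X \<in> weight_ge 3" "\<phi> \<in> infinitesimal_characters scale" "\<psi> \<in> infinitesimal_characters scale" for \<phi> \<psi> X
    unfolding lin_ext_def
  proof (rule sum.neutral, clarify)
    fix a b assume "(a, b) \<in> Poly_Mapping.keys X"
    then have "length (factors a) \<noteq> 1 \<or> length (factors b) \<noteq> 1"
      using that(1) by (force simp: weight_ge_def)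
    then show "scale (Poly_Mapping.lookup X (a, b)) (\<phi> (Poly_Mapping.single a 1) * \<psi> (Poly_Mapping.single b 1)) = 0"
      using that(2,3) by (auto simp: infinitesimal_characters_iff)
  qed
  have ne: "[] \<notin> set (factors b)" using factors[of b] by simp
  consider "factors b = []" | w1 w2 where "factors b = [w1, w2]" | "3 \<le> length (factors b)"
    by (metis b length_Cons list.size(3) neq_Nil_conv numeral_3_eq_3 One_nat_def Suc_le_mono le0)
  then show ?thesis
  proof cases
    case 1
    then show ?thesis unfolding conv by (simp add: mult.commute zero_prod_def flip: single_one)
  next
    case (2 w1 w2)
    let ?A = "\<lambda>w. Poly_Mapping.single (bars [w], 0) (1 :: 'k)"
    let ?B = "\<lambda>w. Poly_Mapping.single (0, bars [w]) (1 :: 'k)"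
    from 2 ne have w: "w1 \<noteq> []" "w2 \<noteq> []" by auto
    obtain R1 where R1: "R1 \<in> weight_ge 2" "coprod_word w1 = ?A w1 + ?B w1 + R1"
      using coprod_word_primitive_part[OF w(1)] by blast
    obtain R2 where R2: "R2 \<in> weight_ge 2" "coprod_word w2 = ?A w2 + ?B w2 + R2"
      using coprod_word_primitive_part[OF w(2)] by blast
    \<comment> \<open>Everything in the product of the two coproducts involving \<open>R1\<close> or
      \<open>R2\<close>; its summands have weight at least 2 + 1 and 1 + 2.\<close>
    define Y where "Y = R1 * coprod_word w2 + (?A w1 + ?B w1) * R2"
    have X: "?X = (?A w1 * ?A w2 + ?A w1 * ?B w2 + ?B w1 * ?A w2 + ?B w1 * ?B w2) + Y"
      unfolding Y_def 2 by (simp add: R1(2) R2(2) algebra_simps)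
    have "?A w1 + ?B w1 \<in> weight_ge 1"
      using w by (simp add: weight_ge_add weight_ge_single)
    from weight_ge_mult[OF this R2(1)] weight_ge_mult[OF R1(1) coprod_word_weight[OF w(2)]]
    have "R1 * coprod_word w2 \<in> weight_ge 3" "(?A w1 + ?B w1) * R2 \<in> weight_ge 3"
      by (simp_all add: eval_nat_numeral)
    then have Y: "Y \<in> weight_ge 3" unfolding Y_def by (simp add: weight_ge_add)
    have z: "\<phi> 1 = 0" "\<psi> 1 = 0"
      using \<phi> \<psi> by (simp_all add: infinitesimal_characters_def)
    \<comment> \<open>The terms with a unit on one side die because both characters vanish at
      \<open>1\<close>. The two mixed terms are exchanged, up to the order of factors in A, when
      \<phi> and \<psi> are swapped.\<close>
    show ?thesis
      unfolding conv X lin_ext_add van[OF Y \<phi> \<psi>] van[OF Y \<psi> \<phi>]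
      by (simp add: mult_single z ac_simps)
  next
    case 3
    then have "?X \<in> weight_ge 3"
      using prod_coprod_word_weight[OF ne] weight_ge_mono by blast
    then show ?thesis unfolding conv by (simp add: van \<phi> \<psi>)
  qed
qed

text \<open>A single convolution is in general non-zero on bar words with two factors;
  \<open>convolution_commute\<close> makes the difference vanish on every bar word that is not a
  single word.\<close>

lemma conv_bracket_closed:
  assumes "\<phi> \<in> infinitesimal_characters scale" "\<psi> \<in> infinitesimal_characters scale"
  shows "conv_bracket scale \<phi> \<psi> \<in> infinitesimal_characters scale"
proof -
  have "Vector_Spaces.linear tscale scale (conv_bracket scale \<phi> \<psi>)"
    by (rule linear_tscaleI)
      (simp_all add: conv_bracket_def convolution_eq_lin_ext coprod_add coprod_tscale lin_ext_add
        lin_ext_tscale scale_right_diff_distrib)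
  then show ?thesis
    using convolution_commute[OF assms]
    by (simp add: infinitesimal_characters_iff conv_bracket_def)
qed

lemma subspace_infinitesimal_characters:
  "module.subspace (\<lambda>c \<phi> t. scale c (\<phi> t)) (infinitesimal_characters scale)"
proof -
  interpret F: vector_space "\<lambda>c (\<phi> :: 'k tens \<Rightarrow> 'a) t. scale c (\<phi> t)"
    by (rule vector_space_pointwise)
  show ?thesis
    by (auto simp: F.subspace_def infinitesimal_characters_iff Vector_Spaces.linear_iff
        vector_space_axioms vector_space_tscale scale_right_distrib scale_left_commute)
qed

end

theorem theorem4p4:
  fixes scale :: "'k::field_char_0 \<Rightarrow> 'a::{comm_ring, comm_monoid_mult} \<Rightarrow> 'a"
  assumes "comm_unital_algebra scale"
  shows "lie_algebra_iso
           (\<lambda>c \<phi> t. scale c (\<phi> t)) (infinitesimal_characters scale) (conv_bracket scale)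
           (\<lambda>c f w. scale c (f w)) G0 series_bracket
           Lambda_Lie"
proof -
  interpret comm_unital_algebra scale by (rule assms)
  \<comment> \<open>The bijection and the compatibility with brackets are already available;
    additivity and homogeneity of \<open>Lambda_Lie\<close> are checked coefficient by
    coefficient.\<close>
  show ?thesis
    by (rule lie_algebra_iso_pullback)
      (simp_all add: lie_algebra_G0 vector_space_pointwise subspace_infinitesimal_characters
        bij_betw_Lambda_Lie conv_bracket_closed Lambda_Lie_conv_bracket,
       simp_all add: Lambda_Lie_def fun_eq_iff)
qed

end
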